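(* Let $\mathbb{S}:=\mathbb{J}$ when $M^T=M$, and $\mathbb{S}\in\{\mathbb{J},\mathbb{L}\}$ when $M^T=-M$. Let $A\in\mathbb{S}$. Then for $\lambda\in\mathbb{C}$ there exists $\Delta A\in\mathbb{S}$ such that $\lambda\in\Lambda(A+\Delta A)$ and $\eta^{\mathbb{S}}(\lambda,A)=\|\Delta A\|_2=\eta(\lambda,A)$. Consequently, $$\Lambda^{\mathbb{S}}_\epsilon(A)=\Lambda_\epsilon(A).$$
   Context: Here $\mathbb{K}=\mathbb{C}$. $M\in\mathbb{C}^{n\times n}$ is unitary with $M^T=M$ or $M^T=-M$, defining the bilinear form $\langle x,y\rangle_M=y^TMx$ on $\mathbb{C}^n$ with adjoint $A^\star=M^{-1}A^TM$; $\mathbb{J}=\{A\in\mathbb{C}^{n\times n}:A^\star=A\}$, $\mathbb{L}=\{A\in\mathbb{C}^{n\times n}:A^\star=-A\}$. $\Lambda(A)$ denotes the spectrum of $A$. For $\lambda\in\mathbb{C}$, $x\in\mathbb{C}^n$, let $\eta^{\mathbb{S}}(A,x,\lambda):=\inf\{\|\Delta A\|_2:\Delta A\in\mathbb{S},\ (A+\Delta A)x=\lambda x\}$ ($=\infty$ if no such $\Delta A$ exists), and $\eta^{\mathbb{S}}(\lambda,A):=\inf\{\eta^{\mathbb{S}}(A,x,\lambda):x\in\mathbb{C}^n,\ \|x\|_2=1\}$. $\eta(\lambda,A)$ denotes $\eta^{\mathbb{S}}(\lambda,A)$ for $\mathbb{S}=\mathbb{C}^{n\times n}$. For $\epsilon>0$,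 the structured pseudospectrum is $\Lambda^{\mathbb{S}}_\epsilon(A):=\bigcup_{\|\Delta A\|_2\le\epsilon}\{\Lambda(A+\Delta A):\Delta A\in\mathbb{S}\}=\{\lambda\in\mathbb{C}:\eta^{\mathbb{S}}(\lambda,A)\le\epsilon\}$, and $\Lambda_\epsilon(A)$ (unstructured pseudospectrum) denotes it for $\mathbb{S}=\mathbb{C}^{n\times n}$. *)

theory Defs
  imports "HOL-Analysis.Analysis"
begin

definition cadjoint :: "complex ^ 'n ^ 'm \<Rightarrow> complex ^ 'm ^ 'n" where
  "cadjoint M = map_matrix cnj (transpose M)"

definition unitary_matrix :: "complex ^ 'n ^ 'n \<Rightarrow> bool" where
  "unitary_matrix M \<longleftrightarrow> cadjoint M ** M = mat 1 \<and> M ** cadjoint M = mat 1"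

text \<open>The form \<open>\<langle>x, y\<rangle>\<^sub>M = y\<^sup>T M x\<close>; it is bilinear, there is no conjugation.\<close>

definition bilinear_form :: "complex ^ 'n ^ 'n \<Rightarrow> complex ^ 'n \<Rightarrow> complex ^ 'n \<Rightarrow> complex" where
  "bilinear_form M x y = (\<Sum>i\<in>UNIV. y $ i * (M *v x) $ i)"

definition form_adjoint :: "complex ^ 'n ^ 'n \<Rightarrow> complex ^ 'n ^ 'n \<Rightarrow> complex ^ 'n ^ 'n" where
  "form_adjoint M A = matrix_inv M ** transpose A ** M"

definition jordan_algebra :: "complex ^ 'n ^ 'n \<Rightarrow> (complex ^ 'n ^ 'n) set" where
  "jordan_algebra M = {A. form_adjoint M A = A}"

definition lie_algebra :: "complex ^ 'n ^ 'n \<Rightarrow> (complex ^ 'n ^ 'n) set" where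
  "lie_algebra M = {A. form_adjoint M A = - A}"

definition spectrum :: "complex ^ 'n ^ 'n \<Rightarrow> complex set" where
  "spectrum A = {\<mu>. \<exists>x. x \<noteq> 0 \<and> A *v x = \<mu> *s x}"

text \<open>The norm on \<^typ>\<open>complex ^ 'n\<close> is the Euclidean one, so this is the induced 2-norm.\<close>

definition spectral_norm :: "complex ^ 'n ^ 'n \<Rightarrow> real" where
  "spectral_norm A = onorm ((*v) A)"

text \<open>Extended real values, so that the infimum over the empty set is \<open>\<infinity>\<close>.\<close>

definition eigenpair_backward_error ::
  "(complex ^ 'n ^ 'n) set \<Rightarrow> complex ^ 'n ^ 'n \<Rightarrow> complex ^ 'n \<Rightarrow> complex \<Rightarrow> ereal" where
  "eigenpair_backward_error S A x \<mu> =
     (INF D \<in> {D \<in> S. (A + D) *v x = \<mu> *s x}. ereal (spectral_norm D))"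

definition eigenvalue_backward_error ::
  "(complex ^ 'n ^ 'n) set \<Rightarrow> complex \<Rightarrow> complex ^ 'n ^ 'n \<Rightarrow> ereal" where
  "eigenvalue_backward_error S \<mu> A =
     (INF x \<in> {x. norm x = 1}. eigenpair_backward_error S A x \<mu>)"

definition pseudospectrum ::
  "(complex ^ 'n ^ 'n) set \<Rightarrow> real \<Rightarrow> complex ^ 'n ^ 'n \<Rightarrow> complex set" where
  "pseudospectrum S \<epsilon> A = (\<Union>D \<in> {D \<in> S. spectral_norm D \<le> \<epsilon>}. spectrum (A + D))"

lemma bilinear_form_adjoint:
  fixes M A :: "complex ^ 'n ^ 'n"
  assumes "unitary_matrix M" and "transpose M = M \<or> transpose M = - M"
  shows "bilinear_form M (A *v x) y = bilinear_form M x (form_adjoint M A *v y)"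
proof -
  have inv: "invertible M"
    using assms(1) unfolding unitary_matrix_def invertible_def by blast
  have swap: "(\<Sum>i\<in>UNIV. u $ i * (B *v v) $ i) = (\<Sum>i\<in>UNIV. v $ i * (transpose B *v u) $ i)"
    for B :: "complex ^ 'n ^ 'n" and u v
    unfolding matrix_vector_mult_def transpose_def
    by (simp add: sum_distrib_left, subst sum.swap) (simp add: algebra_simps)
  have form: "bilinear_form M (B *v v) u = (\<Sum>i\<in>UNIV. v $ i * (transpose (M ** B) *v u) $ i)"
    for B :: "complex ^ 'n ^ 'n" and u v
    using swap[of u "M ** B" v] by (simp add: bilinear_form_def matrix_vector_mul_assoc)
  have form': "bilinear_form M v w = (\<Sum>i\<in>UNIV. v $ i * (transpose M *v w) $ i)" for v w
    using swap[of w M v] by (simp add: bilinear_form_def)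
  have "M ** matrix_inv M = mat 1"
    using someI_ex[OF inv[unfolded invertible_def]] unfolding matrix_inv_def by blast
  then have MM: "M ** (matrix_inv M ** B) = B" for B :: "complex ^ 'n ^ 'n"
    by (simp add: matrix_mul_assoc)
  have neg1: "- B ** C = - (B ** C)" "B ** (- C) = - (B ** C)" for B C :: "complex ^ 'n ^ 'n"
    by (simp_all add: matrix_matrix_mult_def vec_eq_iff sum_negf)
  have "transpose (M ** A) = transpose M ** form_adjoint M A"
    using assms(2)
    by (auto simp: matrix_transpose_mul form_adjoint_def neg1 MM matrix_mul_assoc[symmetric])
  then show ?thesis
    unfolding form form'[of x] by (simp only: matrix_vector_mul_assoc)
qed

end

theory Submission
  imports Defs
begin

text \<open>
  For a unit vector \<open>x\<close>, every perturbation making \<open>(\<mu>, x)\<close> an eigenpair of \<open>A\<close> sends \<open>x\<close> to the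
  residual \<open>r = \<mu>x - Ax\<close> and so has norm at least \<open>\<parallel>r\<parallel>\<close>. This bound is attained inside \<open>\<S>\<close>:
  left multiplication by the unitary \<open>M\<close> identifies \<open>\<S>\<close> isometrically with the symmetric or the
  skew-symmetric matrices. A symmetric matrix of norm \<open>\<parallel>r\<parallel>\<close> sending \<open>x\<close> to \<open>Mr\<close> always exists, and
  a skew-symmetric one exists as soon as \<open>x\<^sup>T M r = 0\<close>, which is automatic since then
  \<open>M(\<mu> - A)\<close> is itself skew-symmetric. The structured and unstructured errors thus
  agree for each \<open>x\<close>, and minimising over the compact unit sphere gives the theorem.
\<close>

section \<open>Hermitian inner product on complex vectors\<close>

text \<open>Conjugate-linear in the first argument, so \<open>hdot (cnj_vec u) v\<close> is the
  bilinear product of \<open>u\<close> and \<open>v\<close>; norms and transposes are thus handled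
  by one form.\<close>

definition hdot :: "complex ^ 'n \<Rightarrow> complex ^ 'n \<Rightarrow> complex" where
  "hdot u v = (\<Sum>i\<in>UNIV. cnj (u $ i) * v $ i)"

definition cnj_vec :: "complex ^ 'n \<Rightarrow> complex ^ 'n" where
  "cnj_vec u = (\<chi> i. cnj (u $ i))"

lemma cnj_vec_nth [simp]: "cnj_vec u $ i = cnj (u $ i)"
  by (simp add: cnj_vec_def)

lemma hdot_add_right: "hdot u (v + w) = hdot u v + hdot u w"
  by (simp add: hdot_def algebra_simps sum.distrib)

lemma hdot_diff_right: "hdot u (v - w) = hdot u v - hdot u w"
  by (simp add: hdot_def algebra_simps sum_subtractf)

lemma hdot_scale_right: "hdot u (c *s v) = c * hdot u v"
  by (simp add: hdot_def sum_distrib_left mult.left_commute)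

lemma hdot_add_left: "hdot (v + w) u = hdot v u + hdot w u"
  by (simp add: hdot_def algebra_simps sum.distrib)

lemma hdot_scale_left: "hdot (c *s v) u = cnj c * hdot v u"
  by (simp add: hdot_def sum_distrib_left mult.assoc)

lemma cnj_hdot: "cnj (hdot u v) = hdot v u"
  by (simp add: hdot_def mult.commute)

lemma hdot_self: "hdot v v = of_real ((norm v)\<^sup>2)"
  by (simp add: hdot_def norm_vec_def L2_set_def sum_nonneg complex_norm_square mult.commute
      del: of_real_power)

lemma hdot_cnj_vec_commute: "hdot (cnj_vec u) v = hdot (cnj_vec v) u"
  by (simp add: hdot_def mult.commute)

lemma hdot_cnj_vec_right: "hdot u (cnj_vec v) = cnj (hdot (cnj_vec u) v)"
  by (simp add: hdot_def)

lemma norm_cnj_vec [simp]: "norm (cnj_vec u) = norm u"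
  by (simp add: norm_vec_def)

lemma norm_scale_vec: "norm (c *s v) = norm c * norm (v :: complex ^ 'n)"
  by (simp add: norm_vec_def norm_mult L2_set_right_distrib)

lemma norm_add_hdot_orthogonal:
  assumes "hdot u v = 0"
  shows "(norm (u + v))\<^sup>2 = (norm u)\<^sup>2 + (norm v)\<^sup>2"
proof -
  have "hdot v u = 0" using cnj_hdot[of u v] assms by simp
  then have "hdot (u + v) (u + v) = hdot u u + hdot v v"
    using assms by (simp add: hdot_add_left hdot_add_right)
  then show ?thesis
    unfolding hdot_self by (metis of_real_add of_real_eq_iff)
qed

lemma norm_scale_add_orthogonal:
  assumes "hdot u v = 0"
  shows "(norm (c *s u + d *s v))\<^sup>2 = (norm c)\<^sup>2 * (norm u)\<^sup>2 + (norm d)\<^sup>2 * (norm v)\<^sup>2"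
proof -
  have "hdot (c *s u) (d *s v) = 0"
    by (simp add: hdot_scale_left hdot_scale_right assms)
  from norm_add_hdot_orthogonal[OF this] show ?thesis
    by (simp add: norm_scale_vec power_mult_distrib)
qed

text \<open>For \<open>q = 0\<close> the second summand is \<open>0\<close>, as division by zero yields zero.\<close>

lemma bessel_inequality_two:
  assumes "norm x = 1" "hdot x q = 0"
  shows "(norm (hdot x v))\<^sup>2 + (norm (hdot q v))\<^sup>2 / (norm q)\<^sup>2 \<le> (norm v)\<^sup>2"
proof -
  define c where "c = hdot x v"
  define d where "d = hdot q v / of_real ((norm q)\<^sup>2)"
  \<comment> \<open>\<open>w\<close> is the orthogonal projection of \<open>v\<close> onto the span
    of \<open>x\<close> and \<open>q\<close>.\<close>
  define w where "w = c *s x + d *s q"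
  have qx: "hdot q x = 0" using cnj_hdot[of x q] assms by simp
  have "hdot x (v - w) = 0"
    by (simp add: w_def hdot_diff_right hdot_add_right hdot_scale_right assms hdot_self c_def)
  moreover have "hdot q (v - w) = 0"
  proof (cases "q = 0")
    case True then show ?thesis by (simp add: hdot_def)
  next
    case False
    then show ?thesis
      by (simp add: w_def hdot_diff_right hdot_add_right hdot_scale_right qx hdot_self d_def)
  qed
  ultimately have "hdot w (v - w) = 0"
    by (simp add: w_def hdot_add_left hdot_scale_left)
  from norm_add_hdot_orthogonal[OF this] have "(norm w)\<^sup>2 \<le> (norm v)\<^sup>2" by simp
  moreover have "(norm w)\<^sup>2 = (norm c)\<^sup>2 + (norm d)\<^sup>2 * (norm q)\<^sup>2"
    using norm_scale_add_orthogonal[OF assms(2)] assms(1) by (simp add: w_def)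
  moreover have "(norm d)\<^sup>2 * (norm q)\<^sup>2 = (norm (hdot q v))\<^sup>2 / (norm q)\<^sup>2"
    by (cases "q = 0") (simp_all add: d_def norm_divide norm_power power_divide field_simps flip: power_add)
  ultimately show ?thesis by (simp add: c_def)
qed

section \<open>Norm-minimal symmetric and skew-symmetric mappings\<close>

lemma bounded_linear_matrix_vector_mul_complex:
  "bounded_linear ((*v) (A :: complex ^ 'n ^ 'm))"
  by (rule linear_conv_bounded_linear[THEN iffD1], rule linearI)
     (simp_all add: matrix_vector_mult_def vec_eq_iff algebra_simps sum.distrib scaleR_sum_right)

lemma norm_mult_le_spectral_norm: "norm (A *v x) \<le> spectral_norm A * norm x"
  unfolding spectral_norm_def by (rule onorm[OF bounded_linear_matrix_vector_mul_complex])

text \<open>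
  With \<open>r = \<alpha> x\<^sup>* + p\<close>, where \<open>x\<^sup>*\<close> is the entrywise conjugate and \<open>p\<close> is orthogonal to it, \<open>E\<close> acts as
  \<open>\<parallel>r\<parallel>\<close> times an isometry from the span of \<open>x\<close> and \<open>p\<^sup>*\<close> to that of \<open>x\<^sup>*\<close> and \<open>p\<close>, and as zero on
  the orthogonal complement. In the basis \<open>x\<close>, \<open>p\<^sup>*\<close> the remaining free diagonal entry is fixed by
  requiring orthogonal columns; for \<open>s = -1\<close> it vanishes.
\<close>

lemma exists_signed_symmetric_mapping:
  fixes x r :: "complex ^ 'n" and s :: complex
  assumes x: "norm x = 1" and s: "s = 1 \<or> s = -1 \<and> hdot (cnj_vec x) r = 0"
  shows "\<exists>E. transpose E = (\<chi> i j. s * E $ i $ j) \<and> E *v x = r \<and>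
             (\<forall>v. norm (E *v v) \<le> norm r * norm v)"
proof -
  define \<alpha> where "\<alpha> = hdot (cnj_vec x) r"
  define p where "p = r - \<alpha> *s cnj_vec x"
  define k where "k = cnj \<alpha> / of_real ((norm p)\<^sup>2)"
  define E :: "complex ^ 'n ^ 'n" where
    "E = (\<chi> i j. \<alpha> * cnj (x $ i) * cnj (x $ j) + p $ i * cnj (x $ j)
              + s * cnj (x $ i) * p $ j - k * p $ i * p $ j)"
  have s': "s = 1 \<or> s = -1 \<and> \<alpha> = 0" using s by (simp add: \<alpha>_def)
  have xp: "hdot (cnj_vec x) p = 0"
    by (simp add: p_def hdot_diff_right hdot_scale_right hdot_self x \<alpha>_def)
  have r: "r = \<alpha> *s cnj_vec x + 1 *s p" by (simp add: p_def)
  have nr: "(norm r)\<^sup>2 = (norm \<alpha>)\<^sup>2 + (norm p)\<^sup>2"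
    using norm_scale_add_orthogonal[OF xp, of \<alpha> 1] x unfolding r[symmetric] by simp
  have Ev: "E *v v = (\<alpha> * hdot x v + s * hdot (cnj_vec p) v) *s cnj_vec x
                   + (hdot x v - k * hdot (cnj_vec p) v) *s p" for v
    by (simp add: E_def matrix_vector_mult_def hdot_def vec_eq_iff sum_distrib_left
        sum_distrib_right sum.distrib sum_subtractf algebra_simps)
  have "transpose E = (\<chi> i j. s * E $ i $ j)"
    using s' by (auto simp: transpose_def E_def vec_eq_iff k_def algebra_simps)
  moreover have "E *v x = r"
    using xp hdot_cnj_vec_commute[of x p] x
    by (simp add: Ev hdot_self r[symmetric]) (simp add: p_def)
  moreover have "norm (E *v v) \<le> norm r * norm v" for v
  proof -
    define a where "a = hdot x v"
    define b where "b = hdot (cnj_vec p) v"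
    have "hdot x (cnj_vec p) = 0" by (simp add: hdot_cnj_vec_right xp)
    from bessel_inequality_two[OF x this, of v]
    have bes: "(norm a)\<^sup>2 + (norm b)\<^sup>2 / (norm p)\<^sup>2 \<le> (norm v)\<^sup>2"
      by (simp add: a_def b_def)
    have "(norm (E *v v))\<^sup>2 =
        (norm (\<alpha> * a + s * b))\<^sup>2 + (norm (a - k * b))\<^sup>2 * (norm p)\<^sup>2"
      unfolding Ev norm_scale_add_orthogonal[OF xp] by (simp add: x a_def b_def)
    also have "\<dots> = (norm r)\<^sup>2 * ((norm a)\<^sup>2 + (norm b)\<^sup>2 / (norm p)\<^sup>2)"
    proof (cases "p = 0")
      case True
      then have "b = 0" by (simp add: b_def hdot_def)
      then show ?thesis using True nr by (simp add: norm_mult power_mult_distrib)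
    next
      case False
      define P where "P = (norm p)\<^sup>2"
      have P: "P \<noteq> 0" using False by (simp add: P_def)
      \<comment> \<open>Over the complex numbers each squared modulus becomes a product z * cnj z.
        The choice of \<open>k\<close> makes the mixed terms in \<open>a\<close> and
        \<open>b\<close> cancel when \<open>s = 1\<close>; for \<open>s = -1\<close> they vanish
        with \<alpha>.\<close>
      have "complex_of_real ((norm (\<alpha> * a + s * b))\<^sup>2 + (norm (a - k * b))\<^sup>2 * P)
          = complex_of_real (((norm \<alpha>)\<^sup>2 + P) * ((norm a)\<^sup>2 + (norm b)\<^sup>2 / P))"
        using s' P unfolding k_def P_def[symmetric]
        by (elim disjE conjE)
           (simp_all add: complex_norm_square field_simps del: of_real_power)
      then show ?thesis by (simp only: of_real_eq_iff nr P_def)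
    qed
    also have "\<dots> \<le> (norm r)\<^sup>2 * (norm v)\<^sup>2"
      using bes by (rule mult_left_mono) simp
    finally have "(norm (E *v v))\<^sup>2 \<le> (norm r * norm v)\<^sup>2"
      by (simp add: power_mult_distrib)
    then show ?thesis by (rule power2_le_imp_le) simp
  qed
  ultimately show ?thesis by blast
qed

section \<open>Unitary matrices and membership in the two algebras\<close>

lemma hdot_adjoint: "hdot u (A *v v) = hdot (cadjoint A *v u) v"
  unfolding hdot_def cadjoint_def matrix_vector_mult_def transpose_def map_matrix_def
  by (simp add: sum_distrib_left sum_distrib_right, subst sum.swap) (simp add: algebra_simps)

lemma norm_unitary_mult:
  assumes "cadjoint U ** U = mat 1"
  shows "norm (U *v v) = norm v"
proof -
  have "hdot (U *v v) (U *v v) = hdot v v"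
    by (simp add: hdot_adjoint matrix_vector_mul_assoc assms)
  then have "(norm (U *v v))\<^sup>2 = (norm v)\<^sup>2"
    unfolding hdot_self of_real_eq_iff .
  then show ?thesis by simp
qed

lemma cadjoint_cadjoint: "cadjoint (cadjoint M) = M"
  by (simp add: cadjoint_def map_matrix_def transpose_def vec_eq_iff)

lemma form_adjoint_eq_iff:
  assumes "unitary_matrix M"
  shows "form_adjoint M A = B \<longleftrightarrow> transpose A ** M = M ** B"
proof -
  have "invertible M"
    using assms unfolding unitary_matrix_def invertible_def by blast
  then have inv: "M ** matrix_inv M = mat 1" "matrix_inv M ** M = mat 1"
    using someI_ex[of "\<lambda>N. M ** N = mat 1 \<and> N ** M = mat 1"]
    unfolding matrix_inv_def invertible_def by auto
  show ?thesis
    unfolding form_adjoint_def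
    by (metis inv matrix_mul_assoc matrix_mul_lid)
qed

lemma matrix_mult_uminus_right: "A ** (- B) = - (A ** (B :: complex ^ 'n ^ 'n))"
  by (simp add: matrix_matrix_mult_def vec_eq_iff sum_negf)

text \<open>Clearing the inverse of \<open>M\<close> leaves \<open>transpose D ** M\<close> equal to
  plus or minus \<open>M ** D\<close>. The sign of \<open>M\<close> under transposition multiplies
  the sign of the algebra, so two minus signs give a symmetric product.\<close>

lemma mem_algebra_iff:
  assumes "unitary_matrix M"
  shows "transpose M = M \<Longrightarrow> D \<in> jordan_algebra M \<longleftrightarrow> transpose (M ** D) = M ** D"
    and "transpose M = - M \<Longrightarrow> D \<in> jordan_algebra M \<longleftrightarrow> transpose (M ** D) = - (M ** D)"
    and "transpose M = - M \<Longrightarrow> D \<in> lie_algebra M \<longleftrightarrow> transpose (M ** D) = M ** D"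
  by (auto simp: jordan_algebra_def lie_algebra_def form_adjoint_eq_iff[OF assms]
      matrix_transpose_mul matrix_mult_uminus_right minus_equation_iff)

text \<open>Transposing the double sum for the bilinear product of \<open>x\<close> with
  \<open>C *v x\<close> leaves its value unchanged but replaces \<open>C\<close> by
  \<open>- C\<close>.\<close>

lemma skew_quadratic_form_zero:
  assumes "transpose C = - C"
  shows "hdot (cnj_vec x) (C *v x) = 0"
proof -
  define Q where "Q = hdot (cnj_vec x) (C *v x)"
  have "Q = (\<Sum>i\<in>UNIV. \<Sum>j\<in>UNIV. x $ i * C $ i $ j * x $ j)"
    by (simp add: Q_def hdot_def matrix_vector_mult_def sum_distrib_left mult.assoc)
  also have "\<dots> = (\<Sum>i\<in>UNIV. \<Sum>j\<in>UNIV. x $ j * C $ j $ i * x $ i)"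
    by (rule sum.swap)
  also have "\<dots> = (\<Sum>i\<in>UNIV. \<Sum>j\<in>UNIV. x $ i * (transpose C) $ i $ j * x $ j)"
    by (simp add: transpose_def mult.commute mult.left_commute)
  also have "\<dots> = - Q"
    by (simp add: assms Q_def hdot_def matrix_vector_mult_def sum_distrib_left mult.assoc sum_negf)
  finally show ?thesis by (simp add: Q_def)
qed

section \<open>Minimal structured perturbations and backward errors\<close>

lemma spectral_norm_attained_on_unit:
  fixes D :: "complex ^ 'n ^ 'n"
  assumes "norm x = 1" "\<And>v. norm (D *v v) \<le> norm (D *v x) * norm v"
  shows "spectral_norm D = norm (D *v x)"
proof (rule antisym)
  show "spectral_norm D \<le> norm (D *v x)"
    unfolding spectral_norm_def using assms(2) by (rule onorm_le)
  show "norm (D *v x) \<le> spectral_norm D"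
    using norm_mult_le_spectral_norm[of D x] assms(1) by simp
qed

lemma exists_structured_minimal_perturbation:
  fixes M A :: "complex ^ 'n ^ 'n"
  assumes U: "unitary_matrix M"
    and S: "(transpose M = M \<and> S = jordan_algebra M) \<or>
         (transpose M = - M \<and> S \<in> {jordan_algebra M, lie_algebra M})"
    and A: "A \<in> S" and x: "norm x = 1"
  shows "\<exists>D\<in>S. (A + D) *v x = \<mu> *s x \<and> spectral_norm D = norm (\<mu> *s x - A *v x)"
proof -
  define r where "r = \<mu> *s x - A *v x"
  \<comment> \<open>The one combination in which \<open>M ** D\<close> must be skew-symmetric; in
    all the others it must be symmetric. The sign \<open>s\<close> lets both be treated at
    once.\<close>
  define skew where "skew \<longleftrightarrow> transpose M = - M \<and> S = jordan_algebra M \<and> transpose M \<noteq> M"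
  define s :: complex where "s = (if skew then -1 else 1)"
  have mem: "D \<in> S \<longleftrightarrow> transpose (M ** D) = (\<chi> i j. s * (M ** D) $ i $ j)" for D
  proof (cases skew)
    case True
    then have "(\<chi> i j. s * (M ** D) $ i $ j) = - (M ** D)"
      by (simp add: s_def vec_eq_iff)
    then show ?thesis
      using mem_algebra_iff(2)[OF U, of D] True unfolding skew_def by simp
  next
    case False
    then have "(\<chi> i j. s * (M ** D) $ i $ j) = M ** D"
      by (simp add: s_def vec_eq_iff)
    then show ?thesis
      using mem_algebra_iff[OF U, of D] S False unfolding skew_def by auto
  qed
  have "s = 1 \<or> s = -1 \<and> hdot (cnj_vec x) (M *v r) = 0"
  proof (cases skew)
    case True
    then have tM: "transpose M = - M" and tMA: "transpose (M ** A) = - (M ** A)"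
      using mem_algebra_iff(2)[OF U, of A] A by (auto simp: skew_def)
    \<comment> \<open>Both \<open>M\<close> and \<open>M ** A\<close> are skew-symmetric here, so
      each term contributes a vanishing quadratic form.\<close>
    have "M *v r = \<mu> *s (M *v x) - (M ** A) *v x"
      by (simp add: r_def matrix_vector_mult_diff_distrib vector_scalar_commute
          matrix_vector_mul_assoc)
    then have "hdot (cnj_vec x) (M *v r) = 0"
      using skew_quadratic_form_zero[OF tM] skew_quadratic_form_zero[OF tMA]
      by (simp add: hdot_diff_right hdot_scale_right)
    then show ?thesis by (simp add: s_def)
  qed (simp add: s_def)
  from exists_signed_symmetric_mapping[OF x this] obtain E where
    E: "transpose E = (\<chi> i j. s * E $ i $ j)" "E *v x = M *v r"
       "\<And>v. norm (E *v v) \<le> norm (M *v r) * norm v"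
    by blast
  define D where "D = cadjoint M ** E"
  have MD: "M ** D = E"
    using U by (simp add: D_def unitary_matrix_def matrix_mul_assoc)
  have "D \<in> S" using E(1) by (simp add: mem MD)
  moreover have Dx: "D *v x = r"
    using U by (simp add: D_def unitary_matrix_def matrix_vector_mul_assoc[symmetric] E(2))
      (simp add: matrix_vector_mul_assoc)
  then have "(A + D) *v x = \<mu> *s x"
    by (simp add: matrix_vector_mult_add_rdistrib r_def)
  \<comment> \<open>\<open>M\<close> and its adjoint preserve norms, so the bound for
    \<open>E\<close> carries over to \<open>D\<close> and is attained at \<open>x\<close>.\<close>
  moreover have "norm (D *v v) \<le> norm (D *v x) * norm v" for v
    using E(3)[of v] norm_unitary_mult[of M] norm_unitary_mult[of "cadjoint M" "E *v v"] U
    unfolding Dx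
    by (simp add: unitary_matrix_def cadjoint_cadjoint D_def matrix_vector_mul_assoc[symmetric])
  then have "spectral_norm D = norm (\<mu> *s x - A *v x)"
    using spectral_norm_attained_on_unit[OF x] Dx by (simp add: r_def)
  ultimately show ?thesis by blast
qed

lemma residual_le_spectral_norm:
  assumes "norm x = 1" "(A + D) *v x = \<mu> *s x"
  shows "norm (\<mu> *s x - A *v x) \<le> spectral_norm D"
proof -
  have "\<mu> *s x - A *v x = D *v x"
    using assms(2) by (simp add: matrix_vector_mult_add_rdistrib algebra_simps)
  then show ?thesis using norm_mult_le_spectral_norm[of D x] assms(1) by simp
qed

text \<open>The set \<open>S\<close> is arbitrary, so a single structured minimiser determines the
  error over its own algebra and over \<open>UNIV\<close> alike.\<close>

lemma eigenpair_backward_error_eq: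
  assumes "norm x = 1" "D \<in> S" "(A + D) *v x = \<mu> *s x"
    and "spectral_norm D = norm (\<mu> *s x - A *v x)"
  shows "eigenpair_backward_error S A x \<mu> = ereal (norm (\<mu> *s x - A *v x))"
  unfolding eigenpair_backward_error_def
proof (rule antisym)
  show "(INF D \<in> {D \<in> S. (A + D) *v x = \<mu> *s x}. ereal (spectral_norm D))
      \<le> ereal (norm (\<mu> *s x - A *v x))"
    using assms by (intro INF_lower2[of D]) auto
  show "ereal (norm (\<mu> *s x - A *v x))
      \<le> (INF D \<in> {D \<in> S. (A + D) *v x = \<mu> *s x}. ereal (spectral_norm D))"
    using residual_le_spectral_norm[OF assms(1)] by (intro INF_greatest) auto
qed

theorem theorem4p4:
  fixes M A :: "complex ^ 'n ^ 'n" and S :: "(complex ^ 'n ^ 'n) set"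
  assumes "unitary_matrix M"
    and "(transpose M = M \<and> S = jordan_algebra M) \<or>
         (transpose M = - M \<and> S \<in> {jordan_algebra M, lie_algebra M})"
    and "A \<in> S"
  shows "(\<forall>\<mu>. \<exists>D\<in>S. \<mu> \<in> spectrum (A + D) \<and>
            eigenvalue_backward_error S \<mu> A = ereal (spectral_norm D) \<and>
            ereal (spectral_norm D) = eigenvalue_backward_error UNIV \<mu> A) \<and>
         (\<forall>\<epsilon>>0. pseudospectrum S \<epsilon> A = pseudospectrum UNIV \<epsilon> A)"
proof (intro conjI allI impI)
  note min = exists_structured_minimal_perturbation[OF assms]
  fix \<mu>
  define f where "f x = norm (\<mu> *s x - A *v x)" for x
  have "continuous_on (sphere 0 1) ((*s) \<mu> :: complex ^ 'n \<Rightarrow> _)"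
    unfolding vector_scalar_mult_def by (intro continuous_intros)
  then have "continuous_on (sphere 0 1) f"
    unfolding f_def
    by (rule continuous_on_norm[OF continuous_on_diff[OF _
            linear_continuous_on[OF bounded_linear_matrix_vector_mul_complex]]])
  moreover have "sphere 0 1 \<noteq> ({} :: (complex ^ 'n) set)"
    by simp
  ultimately obtain x where x: "x \<in> sphere 0 1" and le: "\<And>y. y \<in> sphere 0 1 \<Longrightarrow> f x \<le> f y"
    using continuous_attains_inf[OF compact_sphere, of 0 1 f] by blast
  \<comment> \<open>Needed for \<open>T = S\<close> and \<open>T = UNIV\<close>: the minimiser found
    in \<open>S\<close> also lies in \<open>T\<close>, so both errors are the minimum of the same
    residual norm \<open>f\<close>.\<close>
  have err: "eigenvalue_backward_error T \<mu> A = ereal (f x)" if "S \<subseteq> T" for T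
  proof -
    have "eigenpair_backward_error T A y \<mu> = ereal (f y)" if "norm y = 1" for y
      using min[OF that, of \<mu>] eigenpair_backward_error_eq[OF that] \<open>S \<subseteq> T\<close>
      unfolding f_def by blast
    then have "eigenvalue_backward_error T \<mu> A = (INF y \<in> sphere 0 1. ereal (f y))"
      unfolding eigenvalue_backward_error_def by (intro INF_cong) auto
    also have "\<dots> = ereal (f x)"
      using x le by (intro antisym INF_lower INF_greatest) auto
    finally show ?thesis .
  qed
  from x have nx: "norm x = 1" by simp
  then have "x \<noteq> 0" by auto
  with min[OF nx, of \<mu>] show "\<exists>D\<in>S. \<mu> \<in> spectrum (A + D) \<and>
            eigenvalue_backward_error S \<mu> A = ereal (spectral_norm D) \<and>
            ereal (spectral_norm D) = eigenvalue_backward_error UNIV \<mu> A"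
    unfolding err[OF order_refl] err[OF subset_UNIV] spectrum_def f_def by auto
next
  fix \<epsilon> :: real
  show "pseudospectrum S \<epsilon> A = pseudospectrum UNIV \<epsilon> A"
  proof
    show "pseudospectrum S \<epsilon> A \<subseteq> pseudospectrum UNIV \<epsilon> A"
      unfolding pseudospectrum_def by blast
    show "pseudospectrum UNIV \<epsilon> A \<subseteq> pseudospectrum S \<epsilon> A"
    proof
      fix \<mu> assume "\<mu> \<in> pseudospectrum UNIV \<epsilon> A"
      then obtain D z where D: "spectral_norm D \<le> \<epsilon>" and z: "z \<noteq> 0" "(A + D) *v z = \<mu> *s z"
        unfolding pseudospectrum_def spectrum_def by blast
      \<comment> \<open>Minimal perturbations are available for unit vectors, so the eigenvector is
        normalised. Its residual norm is at most that of \<open>D\<close>, hence at most \<epsilon>,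
        and \<open>D'\<close> attains it inside \<open>S\<close>.\<close>
      define x where "x = complex_of_real (1 / norm z) *s z"
      have nx: "norm x = 1" using z by (simp add: x_def norm_scale_vec norm_divide)
      have "(A + D) *v x = \<mu> *s x"
        unfolding x_def vector_scalar_commute z(2) by (simp add: vec_eq_iff)
      from residual_le_spectral_norm[OF nx this] D
      obtain D' where "D' \<in> S" "(A + D') *v x = \<mu> *s x" "spectral_norm D' \<le> \<epsilon>"
        using exists_structured_minimal_perturbation[OF assms nx, of \<mu>] by force
      moreover have "x \<noteq> 0" using nx by auto
      ultimately show "\<mu> \<in> pseudospectrum S \<epsilon> A"
        unfolding pseudospectrum_def spectrum_def by blast
    qed
  qed
qed

end
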